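(* Let $M$ be a pseudomeadow with finitely many minimal idempotents, and suppose that for every non-zero idempotent $e\in M$ there exists a minimal idempotent $e'\in M$ such that $e'\le e$. Let $\{e_1,\dots,e_n\}$ be the set of all (distinct) minimal idempotents of $M$. Then: (a) $M$ is a meadow (i.e. it has a multiplicative identity element), and its identity element is equal to $e_1+\dots+e_n$, the sum of all minimal idempotents of $M$. (b) Moreover, $M$ is isomorphic to a finite product of fields, namely $M\cong Me_1\times\cdots\times Me_n$. (c) $M$ has finitely many idempotents, and each of them is a sum of distinct minimal idempotents of $M$.
   Context: A pseudoring is a commutative associative ring that is not required to have a multiplicative identity. A pseudomeadow is a pseudoring $R$ in which every $x\in R$ has a von Neumann inverse, i.e. an element $x^{(-1)}\in R$ (necessarily unique) with $x\,x\,x^{(-1)}=x$ and $x\,x^{(-1)}x^{(-1)}=x^{(-1)}$. A meadow is a pseudomeadow with a multiplicative identity element $1$ (the zero ring, with $1=0$, is allowed). An idempotent is an element $e$ with $e^2=e$ (so $0$ is an idempotent). Idempotents are partially ordered by $e\le f$ iff $ef=e$. A minimal idempotent is an idempotent $e\neq 0$ such that for every non-zero idempotent $f$, $f\le e$ implies $f=e$. For an idempotent $e$, $Me=\{xe: x\in M\}$, with the operations induced from $M$; when $e$ is a minimal idempotent of a pseudomeadow, $Me$ is a field with identity element $e$. Isomorphism means a bijective map preserving addition and multiplication. Conventions: the empty sum is $0$ and the empty product of fields is the zero ring (this covers $M=\{0\}$, $n=0$). *)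

theory Defs
  imports "HOL-Algebra.Chinese_Remainder"
begin

text \<open>
  The carrier type is the library's ring record. Its field \<open>one\<close> is left unconstrained by the locales
  \<open>pseudoring\<close> and \<open>pseudomeadow\<close>; having an identity is the separate existence statement in \<open>meadow\<close>.
\<close>

locale pseudoring = abelian_group R for R (structure) +
  assumes mult_closed: "\<lbrakk> x \<in> carrier R; y \<in> carrier R \<rbrakk> \<Longrightarrow> x \<otimes> y \<in> carrier R"
    and mult_assoc: "\<lbrakk> x \<in> carrier R; y \<in> carrier R; z \<in> carrier R \<rbrakk>
      \<Longrightarrow> (x \<otimes> y) \<otimes> z = x \<otimes> (y \<otimes> z)"
    and mult_comm: "\<lbrakk> x \<in> carrier R; y \<in> carrier R \<rbrakk> \<Longrightarrow> x \<otimes> y = y \<otimes> x"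
    and distr: "\<lbrakk> x \<in> carrier R; y \<in> carrier R; z \<in> carrier R \<rbrakk>
      \<Longrightarrow> (x \<oplus> y) \<otimes> z = x \<otimes> z \<oplus> y \<otimes> z"

definition vn_inverse :: "('a, 'm) ring_scheme \<Rightarrow> 'a \<Rightarrow> 'a \<Rightarrow> bool" where
  "vn_inverse R x y \<longleftrightarrow> y \<in> carrier R \<and>
     x \<otimes>\<^bsub>R\<^esub> x \<otimes>\<^bsub>R\<^esub> y = x \<and> x \<otimes>\<^bsub>R\<^esub> y \<otimes>\<^bsub>R\<^esub> y = y"

locale pseudomeadow = pseudoring R for R (structure) +
  assumes vn_inverse_exists: "x \<in> carrier R \<Longrightarrow> \<exists>y. vn_inverse R x y"

definition is_identity :: "('a, 'm) ring_scheme \<Rightarrow> 'a \<Rightarrow> bool" where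
  "is_identity R u \<longleftrightarrow> u \<in> carrier R \<and>
     (\<forall>x \<in> carrier R. u \<otimes>\<^bsub>R\<^esub> x = x \<and> x \<otimes>\<^bsub>R\<^esub> u = x)"

locale meadow = pseudomeadow R for R (structure) +
  assumes identity_exists: "\<exists>u. is_identity R u"

definition idempotents :: "('a, 'm) ring_scheme \<Rightarrow> 'a set" where
  "idempotents R = {e \<in> carrier R. e \<otimes>\<^bsub>R\<^esub> e = e}"

definition idem_le :: "('a, 'm) ring_scheme \<Rightarrow> 'a \<Rightarrow> 'a \<Rightarrow> bool" where
  "idem_le R e f \<longleftrightarrow> e \<otimes>\<^bsub>R\<^esub> f = e"

definition minimal_idempotents :: "('a, 'm) ring_scheme \<Rightarrow> 'a set" where
  "minimal_idempotents R = {e \<in> idempotents R. e \<noteq> \<zero>\<^bsub>R\<^esub> \<and>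
     (\<forall>f \<in> idempotents R. f \<noteq> \<zero>\<^bsub>R\<^esub> \<longrightarrow> idem_le R f e \<longrightarrow> f = e)}"

text \<open>
  \<open>component R e\<close> is the set of all x e with x in R, with the induced operations. Its \<open>one\<close> is set to \<open>e\<close>, so that the library
  predicate \<open>field\<close> applies to it.
\<close>

definition component :: "('a, 'm) ring_scheme \<Rightarrow> 'a \<Rightarrow> ('a, 'm) ring_scheme" where
  "component R e = R\<lparr> carrier := (\<lambda>x. x \<otimes>\<^bsub>R\<^esub> e) ` carrier R, one := e \<rparr>"

text \<open>
  Unlike the library's \<open>ring_iso\<close>, this does not mention the \<open>one\<close> fields of the records, since
  that of a pseudoring is meaningless.
\<close>

definition pseudoring_iso ::
  "('a, 'm) ring_scheme \<Rightarrow> ('b, 'n) ring_scheme \<Rightarrow> ('a \<Rightarrow> 'b) set" where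
  "pseudoring_iso R S = {h. bij_betw h (carrier R) (carrier S) \<and>
     (\<forall>x \<in> carrier R. \<forall>y \<in> carrier R.
        h (x \<oplus>\<^bsub>R\<^esub> y) = h x \<oplus>\<^bsub>S\<^esub> h y \<and> h (x \<otimes>\<^bsub>R\<^esub> y) = h x \<otimes>\<^bsub>S\<^esub> h y)}"

definition is_pseudoring_iso ::
  "('a, 'm) ring_scheme \<Rightarrow> ('b, 'n) ring_scheme \<Rightarrow> bool" where
  "is_pseudoring_iso R S \<longleftrightarrow> pseudoring_iso R S \<noteq> {}"

end

theory Submission
  imports Defs
begin

text \<open>
  Distinct minimal idempotents are orthogonal. Let \<open>u\<close> be the sum of all of them. For \<open>x\<close> in \<open>M\<close>, put
  \<open>y = x - u x\<close>; then \<open>y\<close> is annihilated by every minimal idempotent, and so is the idempotent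
  \<open>y z\<close>, where \<open>z\<close> is the von Neumann inverse of \<open>y\<close>. Since a minimal idempotent lies below any
  non-zero idempotent, \<open>y z = 0\<close> and hence \<open>y = y z y = 0\<close>, that is, \<open>u x = x\<close>. Now
  \<open>x = \<Sum>\<^sub>i x e\<^sub>i\<close>, which yields the decomposition of \<open>M\<close> as well as that of an idempotent \<open>f\<close>,
  because each \<open>f e\<^sub>i\<close> is \<open>0\<close> or \<open>e\<^sub>i\<close>.
\<close>

section \<open>Pseudoring arithmetic, idempotents and their components\<close>

context pseudoring
begin

lemma mult_lcomm:
  "\<lbrakk> x \<in> carrier R; y \<in> carrier R; z \<in> carrier R \<rbrakk> \<Longrightarrow> x \<otimes> (y \<otimes> z) = y \<otimes> (x \<otimes> z)"
  by (metis mult_assoc mult_comm)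

lemmas mult_ac = mult_assoc mult_comm mult_lcomm

lemma zero_mult: "x \<in> carrier R \<Longrightarrow> \<zero> \<otimes> x = \<zero>"
  by (metis add.l_cancel_one distr l_zero mult_closed zero_closed)

lemma mult_zero: "x \<in> carrier R \<Longrightarrow> x \<otimes> \<zero> = \<zero>"
  by (metis mult_comm zero_closed zero_mult)

lemma distr_right:
  "\<lbrakk> x \<in> carrier R; y \<in> carrier R; z \<in> carrier R \<rbrakk> \<Longrightarrow> z \<otimes> (x \<oplus> y) = z \<otimes> x \<oplus> z \<otimes> y"
  by (metis a_closed distr mult_comm)

lemma finsum_mult:
  assumes "x \<in> carrier R" "g \<in> A \<rightarrow> carrier R"
  shows "(\<Oplus>i\<in>A. g i) \<otimes> x = (\<Oplus>i\<in>A. g i \<otimes> x)"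
proof (cases "finite A")
  case True
  then show ?thesis
    using assms(2)
  proof induction
    case empty
    then show ?case by (simp add: assms(1) zero_mult)
  next
    case (insert a A)
    then have "g a \<in> carrier R" "g \<in> A \<rightarrow> carrier R" "(\<lambda>i. g i \<otimes> x) \<in> A \<rightarrow> carrier R"
      by (auto simp: assms(1) Pi_iff mult_closed)
    with insert show ?case
      by (simp add: finsum_insert distr finsum_closed mult_closed assms(1))
  qed
next
  \<comment> \<open>Over an infinite \<open>A\<close> both sums are \<open>\<zero>\<close> by
    convention, so \<open>\<zero> \<otimes> x = \<zero>\<close> suffices.\<close>
  case False
  then show ?thesis by (simp add: finsum_infinite assms(1) zero_mult)
qed

lemma idempotents_mult:
  assumes "e \<in> idempotents R" "f \<in> idempotents R"
  shows "e \<otimes> f \<in> idempotents R"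
proof -
  have c: "e \<in> carrier R" "f \<in> carrier R" "e \<otimes> e = e" "f \<otimes> f = f"
    using assms by (auto simp: idempotents_def)
  have "e \<otimes> f \<otimes> (e \<otimes> f) = (e \<otimes> e) \<otimes> (f \<otimes> f)"
    using c(1,2) by (simp add: mult_ac mult_closed)
  with c show ?thesis by (simp add: idempotents_def mult_closed)
qed

lemma minimal_idempotentD:
  assumes "e \<in> minimal_idempotents R"
  shows "e \<in> carrier R" "e \<otimes> e = e" "e \<noteq> \<zero>" "e \<in> idempotents R"
  using assms by (auto simp: minimal_idempotents_def idempotents_def)

text \<open>\<open>e \<otimes> f\<close> is an idempotent below \<open>e\<close>, so minimality
  leaves only the values \<open>\<zero>\<close> and \<open>e\<close>.\<close>

lemma minimal_idempotent_mult_idempotent: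
  assumes "e \<in> minimal_idempotents R" "f \<in> idempotents R" "e \<otimes> f \<noteq> \<zero>"
  shows "e \<otimes> f = e"
proof -
  note e = minimal_idempotentD[OF assms(1)]
  have f: "f \<in> carrier R" using assms(2) by (simp add: idempotents_def)
  have "e \<otimes> f \<otimes> e = (e \<otimes> e) \<otimes> f"
    using e(1) f by (simp add: mult_ac mult_closed)
  then have "idem_le R (e \<otimes> f) e" using e(2) by (simp add: idem_le_def)
  with assms(1,3) idempotents_mult[OF e(4) assms(2)] show ?thesis
    by (auto simp: minimal_idempotents_def)
qed

text \<open>A non-zero product would equal \<open>e\<close> by minimality of \<open>e\<close> and
  \<open>f\<close> by minimality of \<open>f\<close>.\<close>

lemma minimal_idempotents_orthogonal:
  assumes "e \<in> minimal_idempotents R" "f \<in> minimal_idempotents R" "e \<noteq> f"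
  shows "e \<otimes> f = \<zero>"
  using assms
  by (metis minimal_idempotent_mult_idempotent minimal_idempotentD(1,4) mult_comm)

text \<open>As \<open>e \<otimes> e = e\<close>, the multiples of \<open>e\<close> are the fixed
  points of multiplication by \<open>e\<close>. This turns membership into an equation that can be
  checked without a witness.\<close>

lemma carrier_component:
  assumes "e \<in> idempotents R"
  shows "carrier (component R e) = {x \<in> carrier R. x \<otimes> e = x}"
proof -
  have "e \<in> carrier R" "e \<otimes> e = e" using assms by (auto simp: idempotents_def)
  then show ?thesis
    by (auto simp: component_def mult_closed mult_assoc image_iff) metis
qed

text \<open>The fixed points of \<open>e\<close> are closed under both operations, and
  \<open>e\<close> is neutral on them.\<close>

lemma component_cring:
  assumes e: "e \<in> idempotents R"
  shows "cring (component R e)"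
proof -
  let ?C = "component R e"
  have ec: "e \<in> carrier R" "e \<otimes> e = e" using e by (auto simp: idempotents_def)
  have ops [simp]: "mult ?C = mult R" "add ?C = add R" "zero ?C = \<zero>" "one ?C = e"
    by (simp_all add: component_def)
  note carr [simp] = carrier_component[OF e]
  have "abelian_group ?C"
  proof (rule abelian_groupI)
    fix x assume "x \<in> carrier ?C"
    then have x: "x \<in> carrier R" "x \<otimes> e = x" by auto
    \<comment> \<open>The additive inverse is taken as \<open>\<ominus> x \<otimes> e\<close>, which
      is a multiple of \<open>e\<close> by construction.\<close>
    have "\<ominus> x \<otimes> e \<oplus> x = (\<ominus> x \<oplus> x) \<otimes> e"
      using x ec(1) by (simp add: distr)
    then have "\<ominus> x \<otimes> e \<oplus> x = \<zero>"
      using x ec(1) by (simp add: l_neg zero_mult)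
    moreover have "\<ominus> x \<otimes> e \<in> carrier ?C"
      using x ec by (simp add: mult_closed mult_assoc)
    ultimately show "\<exists>y\<in>carrier ?C. y \<oplus>\<^bsub>?C\<^esub> x = \<zero>\<^bsub>?C\<^esub>"
      unfolding ops by blast
  qed (use ec in \<open>auto simp: a_ac distr zero_mult\<close>)
  moreover have "comm_monoid ?C"
  proof (rule comm_monoidI)
    show "\<one>\<^bsub>?C\<^esub> \<otimes>\<^bsub>?C\<^esub> x = x" if "x \<in> carrier ?C" for x
      using that ec(1) mult_comm[of e x] by simp
    show "x \<otimes>\<^bsub>?C\<^esub> y = y \<otimes>\<^bsub>?C\<^esub> x" if "x \<in> carrier ?C" "y \<in> carrier ?C" for x y
      using that mult_comm by simp
  qed (use ec in \<open>auto simp: mult_closed mult_assoc\<close>)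
  ultimately show ?thesis
    by (rule cringI) (auto simp: distr)
qed

end

section \<open>Von Neumann inverses: fields and the identity element\<close>

context pseudomeadow
begin

text \<open>With \<open>y\<close> the von Neumann inverse, commutativity turns
  \<open>x \<otimes> x \<otimes> y = x\<close> into the last claim, and multiplying that by
  \<open>y\<close> gives idempotency. So \<open>x \<otimes> y\<close> acts as an identity on
  \<open>x\<close> and vanishes only if \<open>x\<close> does.\<close>

lemma obtain_idempotent:
  assumes "x \<in> carrier R"
  obtains y where "y \<in> carrier R" "x \<otimes> y \<in> idempotents R" "x \<otimes> y \<otimes> x = x"
proof -
  obtain y where y: "y \<in> carrier R" "x \<otimes> x \<otimes> y = x" "x \<otimes> y \<otimes> y = y"
    using vn_inverse_exists[OF assms] by (auto simp: vn_inverse_def)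
  have 1: "x \<otimes> y \<otimes> x = x"
    using y(1,2) assms by (simp add: mult_ac mult_closed)
  then have "x \<otimes> y \<otimes> (x \<otimes> y) = x \<otimes> y"
    using y(1) assms by (simp add: mult_assoc[symmetric] mult_closed)
  with 1 that y(1) assms show ?thesis by (simp add: idempotents_def mult_closed)
qed

text \<open>For non-zero \<open>x\<close> in the component, the idempotent
  \<open>x \<otimes> y\<close> is non-zero and lies below \<open>e\<close>, hence equals
  \<open>e\<close> by minimality.\<close>

lemma component_field:
  assumes e: "e \<in> minimal_idempotents R"
  shows "field (component R e)"
proof -
  let ?C = "component R e"
  note em = minimal_idempotentD[OF e]
  have ops [simp]: "mult ?C = mult R" "zero ?C = \<zero>" "one ?C = e"
    by (simp_all add: component_def)
  note carr = carrier_component[OF em(4)]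
  interpret C: cring ?C by (rule component_cring[OF em(4)])
  have "x \<in> Units ?C" if "x \<in> carrier ?C" "x \<noteq> \<zero>" for x
  proof -
    have x: "x \<in> carrier R" "x \<otimes> e = x" using that(1) by (auto simp: carr)
    obtain y where y: "y \<in> carrier R" "x \<otimes> y \<in> idempotents R" "x \<otimes> y \<otimes> x = x"
      using obtain_idempotent[OF x(1)] .
    have exy: "e \<otimes> (x \<otimes> y) = x \<otimes> y"
      using x y(1) em(1) by (metis mult_assoc mult_comm)
    have "x \<otimes> y \<noteq> \<zero>" using y(3) x(1) that(2) zero_mult by metis
    then have xy: "x \<otimes> y = e"
      using minimal_idempotent_mult_idempotent[OF e y(2)] exy by simp
    \<comment> \<open>\<open>y\<close> is only known to lie in \<open>R\<close>; multiplying by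
      \<open>e\<close> moves it into the component and keeps it an inverse of
      \<open>x\<close>.\<close>
    have "y \<otimes> e \<in> carrier ?C" using y(1) em by (simp add: carr mult_closed mult_assoc)
    moreover have "x \<otimes> (y \<otimes> e) = e" "y \<otimes> e \<otimes> x = e"
      using x y(1) em xy by (metis mult_assoc mult_comm mult_closed)+
    ultimately show ?thesis
      using that(1) unfolding Units_def ops by blast
  qed
  moreover have "\<zero> \<notin> Units ?C"
    using em(1,3) by (auto simp: Units_def carr mult_zero zero_mult)
  ultimately show ?thesis
    by (intro C.cring_fieldI) (auto simp: Units_def)
qed

lemma sum_minimal_idempotents_is_identity:
  assumes fin: "finite (minimal_idempotents R)"
    and below: "\<And>e. e \<in> idempotents R \<Longrightarrow> e \<noteq> \<zero> \<Longrightarrow>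
      \<exists>e' \<in> minimal_idempotents R. idem_le R e' e"
  shows "is_identity R (\<Oplus>e \<in> minimal_idempotents R. e)"
proof -
  let ?E = "minimal_idempotents R"
  define u where "u = (\<Oplus>e \<in> ?E. e)"
  have Ec: "(\<lambda>e. e) \<in> ?E \<rightarrow> carrier R" by (auto dest: minimal_idempotentD(1))
  have u: "u \<in> carrier R" unfolding u_def by (rule finsum_closed[OF Ec])
  have ue: "u \<otimes> e = e" if e: "e \<in> ?E" for e
  proof -
    have "u \<otimes> e = (\<Oplus>f \<in> ?E. f \<otimes> e)"
      unfolding u_def by (rule finsum_mult[OF minimal_idempotentD(1)[OF e] Ec])
    \<comment> \<open>By orthogonality only the summand \<open>f = e\<close> survives.\<close>
    also have "\<dots> = (\<Oplus>f \<in> ?E. if e = f then f else \<zero>)"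
      by (rule finsum_cong')
        (use e in \<open>auto simp: minimal_idempotents_orthogonal dest: minimal_idempotentD\<close>)
    also have "\<dots> = e" by (rule finsum_singleton[OF e fin Ec])
    finally show ?thesis .
  qed
  have "u \<otimes> x = x" if x: "x \<in> carrier R" for x
  proof -
    define y where "y = x \<ominus> u \<otimes> x"
    have y: "y \<in> carrier R" unfolding y_def using x u by (simp add: mult_closed)
    have xy: "x = y \<oplus> u \<otimes> x"
      unfolding y_def using x u
      by (simp add: a_minus_def a_assoc l_neg mult_closed)
    have ey: "e \<otimes> y = \<zero>" if e: "e \<in> ?E" for e
    proof -
      note ec = minimal_idempotentD(1)[OF e]
      \<comment> \<open>Since \<open>u\<close> fixes \<open>e\<close>, this becomes
        \<open>e \<otimes> x = e \<otimes> y \<oplus> e \<otimes> x\<close>, and cancelling leaves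
        \<open>e \<otimes> y = \<zero>\<close>.\<close>
      have "e \<otimes> x = e \<otimes> y \<oplus> e \<otimes> (u \<otimes> x)"
        using xy distr_right[OF y mult_closed[OF u x] ec] by simp
      also have "e \<otimes> (u \<otimes> x) = e \<otimes> x"
        using ue[OF e] ec u x by (metis mult_assoc mult_comm)
      finally show ?thesis
        using ec x y by (metis add.r_cancel_one' mult_closed)
    qed
    obtain z where z: "z \<in> carrier R" "y \<otimes> z \<in> idempotents R" "y \<otimes> z \<otimes> y = y"
      using obtain_idempotent[OF y] .
    have "y \<otimes> z = \<zero>"
    proof (rule ccontr)
      assume "y \<otimes> z \<noteq> \<zero>"
      then obtain e where e: "e \<in> ?E" "e \<otimes> (y \<otimes> z) = e"
        using below[OF z(2)] by (auto simp: idem_le_def)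
      then have "e = \<zero>"
        using ey[OF e(1)] minimal_idempotentD(1)[OF e(1)] y z(1) by (metis mult_assoc zero_mult)
      with e(1) show False using minimal_idempotentD(3) by blast
    qed
    then have "y = \<zero>" using z(3) y zero_mult by metis
    with xy x u show ?thesis by (metis l_zero mult_closed)
  qed
  then show ?thesis
    using u by (auto simp: is_identity_def u_def[symmetric] mult_comm)
qed

end

section \<open>The isomorphism onto the product of the components\<close>

text \<open>Consing is a homomorphism from the binary product of \<open>R\<close> and
  \<open>RDirProd_list Rs\<close>, whose operations are componentwise.\<close>

lemma RDirProd_list_Cons_ops:
  assumes "a \<in> carrier R" "b \<in> carrier R"
    and "as \<in> carrier (RDirProd_list Rs)" "bs \<in> carrier (RDirProd_list Rs)"
  shows "(a # as) \<otimes>\<^bsub>RDirProd_list (R # Rs)\<^esub> (b # bs)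
      = (a \<otimes>\<^bsub>R\<^esub> b) # (as \<otimes>\<^bsub>RDirProd_list Rs\<^esub> bs)"
    and "(a # as) \<oplus>\<^bsub>RDirProd_list (R # Rs)\<^esub> (b # bs)
      = (a \<oplus>\<^bsub>R\<^esub> b) # (as \<oplus>\<^bsub>RDirProd_list Rs\<^esub> bs)"
  using ring_hom_mult[OF RDirProd_list_hom1[of R Rs], of "(a, as)" "(b, bs)"]
    ring_hom_add[OF RDirProd_list_hom1[of R Rs], of "(a, as)" "(b, bs)"] assms
  by (simp_all add: RDirProd_carrier) (simp_all add: RDirProd_def DirProd_def monoid.defs)

text \<open>\<open>h\<close> and \<open>P\<close> take the list as an argument so that the induction
  can pass from \<open>es\<close> to \<open>e # es\<close>.\<close>

lemma (in pseudoring) mult_idempotents_hom: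
  assumes "set es \<subseteq> idempotents R" "x \<in> carrier R" "y \<in> carrier R"
  defines "h \<equiv> \<lambda>es x. map (\<lambda>e. x \<otimes> e) es"
    and "P \<equiv> \<lambda>es. RDirProd_list (map (component R) es)"
  shows "h es x \<in> carrier (P es)"
    and "h es (x \<oplus> y) = h es x \<oplus>\<^bsub>P es\<^esub> h es y"
    and "h es (x \<otimes> y) = h es x \<otimes>\<^bsub>P es\<^esub> h es y"
proof -
  have carr: "h es z \<in> carrier (P es)" if "set es \<subseteq> idempotents R" "z \<in> carrier R" for es z
    unfolding h_def P_def
    by (rule RDirProd_list_carrier_memI)
      (use that in \<open>auto simp: component_def\<close>)
  show "h es x \<in> carrier (P es)" using carr assms(1,2) .
  have "h es (x \<oplus> y) = h es x \<oplus>\<^bsub>P es\<^esub> h es y \<and> h es (x \<otimes> y) = h es x \<otimes>\<^bsub>P es\<^esub> h es y"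
    using assms(1)
  proof (induction es)
    case Nil
    then show ?case by (simp add: h_def P_def monoid.defs)
  next
    case (Cons e es)
    then have e: "e \<in> carrier R" "e \<otimes> e = e" and es: "set es \<subseteq> idempotents R"
      by (auto simp: idempotents_def)
    have c: "x \<otimes> e \<in> carrier (component R e)" "y \<otimes> e \<in> carrier (component R e)"
      using assms by (auto simp: component_def)
    \<comment> \<open>Doubling \<open>e\<close> supplies one factor for \<open>x\<close> and one for
      \<open>y\<close>; this is what makes multiplication by \<open>e\<close>
      multiplicative.\<close>
    have "x \<otimes> y \<otimes> e = x \<otimes> y \<otimes> (e \<otimes> e)" using e(2) by simp
    also have "\<dots> = (x \<otimes> e) \<otimes> (y \<otimes> e)"
      using assms(2,3) e(1) by (simp add: mult_ac mult_closed)
    finally have m: "x \<otimes> y \<otimes> e = (x \<otimes> e) \<otimes> (y \<otimes> e)" .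
    have a: "(x \<oplus> y) \<otimes> e = x \<otimes> e \<oplus> y \<otimes> e"
      using assms(2,3) e(1) by (simp add: distr)
    have ops: "mult (component R e) = mult R" "add (component R e) = add R"
      by (simp_all add: component_def)
    have P_Cons: "P (e # es) = RDirProd_list (component R e # map (component R) es)"
      and h_Cons: "\<And>z. h (e # es) z = (z \<otimes> e) # h es z"
      by (simp_all add: P_def h_def)
    show ?case
      using Cons.IH[OF es]
      unfolding P_Cons h_Cons
        RDirProd_list_Cons_ops[OF c carr[OF es assms(2), unfolded P_def]
          carr[OF es assms(3), unfolded P_def]]
      by (simp add: ops a m P_def)
  qed
  then show "h es (x \<oplus> y) = h es x \<oplus>\<^bsub>P es\<^esub> h es y"
    and "h es (x \<otimes> y) = h es x \<otimes>\<^bsub>P es\<^esub> h es y" by auto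
qed

context pseudoring
begin

text \<open>The identity being the sum of the \<open>e\<close>, every \<open>x\<close> is recovered
  from its components, which gives injectivity; orthogonality gives surjectivity.\<close>

lemma component_decomposition_iso:
  assumes idem: "set es \<subseteq> idempotents R" and dist: "distinct es"
    and orth: "\<And>e f. e \<in> set es \<Longrightarrow> f \<in> set es \<Longrightarrow> e \<noteq> f \<Longrightarrow> e \<otimes> f = \<zero>"
    and ident: "is_identity R (\<Oplus>e \<in> set es. e)"
  shows "(\<lambda>x. map (\<lambda>e. x \<otimes> e) es) \<in> pseudoring_iso R (RDirProd_list (map (component R) es))"
proof -
  let ?h = "\<lambda>x. map (\<lambda>e. x \<otimes> e) es"
  let ?P = "RDirProd_list (map (component R) es)"
  note hom = mult_idempotents_hom[OF idem]
  have esc: "(\<lambda>e. e) \<in> set es \<rightarrow> carrier R" using idem by (auto simp: idempotents_def)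
  have decomp: "x = (\<Oplus>e \<in> set es. e \<otimes> x)" if "x \<in> carrier R" for x
    using ident that finsum_mult[OF that esc] by (simp add: is_identity_def)
  have "inj_on ?h (carrier R)"
  proof (rule inj_onI)
    fix x y assume xy: "x \<in> carrier R" "y \<in> carrier R" "?h x = ?h y"
    then have "e \<otimes> x = e \<otimes> y" if "e \<in> set es" for e
      using that esc by (simp add: mult_comm[of e] Pi_iff)
    then have "(\<Oplus>e \<in> set es. e \<otimes> x) = (\<Oplus>e \<in> set es. e \<otimes> y)"
      using esc xy(2) by (intro finsum_cong') (auto simp: mult_closed Pi_iff)
    then show "x = y" by (simp flip: decomp[OF xy(1)] decomp[OF xy(2)])
  qed
  moreover have "?h ` carrier R = carrier ?P"
  proof
    show "?h ` carrier R \<subseteq> carrier ?P" using hom(1) by blast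
    show "carrier ?P \<subseteq> ?h ` carrier R"
    proof
      fix ys assume "ys \<in> carrier ?P"
      from RDirProd_list_carrier_mem[OF this]
      have len: "length ys = length es"
        and ys: "\<And>i. i < length es \<Longrightarrow> ys ! i \<in> carrier (component R (es ! i))" by auto
      have esi: "es ! i \<in> idempotents R" if "i < length es" for i
        using that idem by auto
      have yc: "ys ! i \<in> carrier R" "ys ! i \<otimes> es ! i = ys ! i" if "i < length es" for i
        using ys[OF that] carrier_component[OF esi[OF that]] by auto
      \<comment> \<open>The preimage of \<open>ys\<close> is the sum of its entries, taken over
        positions because entries may coincide.\<close>
      define x where "x = (\<Oplus>i \<in> {..<length es}. ys ! i)"
      have Pi: "(\<lambda>i. ys ! i) \<in> {..<length es} \<rightarrow> carrier R" using yc by auto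
      have x: "x \<in> carrier R" unfolding x_def by (rule finsum_closed[OF Pi])
      have "x \<otimes> es ! j = ys ! j" if j: "j < length es" for j
      proof -
        have ej: "es ! j \<in> carrier R" using esi[OF j] by (simp add: idempotents_def)
        have "ys ! i \<otimes> es ! j = (if j = i then ys ! i else \<zero>)" if i: "i < length es" for i
        proof (cases "j = i")
          case True
          then show ?thesis using yc[OF i] by simp
        next
          case False
          have ei: "es ! i \<in> carrier R" using esi[OF i] by (simp add: idempotents_def)
          \<comment> \<open>Distinctness of \<open>es\<close> turns \<open>i \<noteq> j\<close> into
            different idempotents. As \<open>ys ! i\<close> absorbs \<open>es ! i\<close>, its
            product with \<open>es ! j\<close> then vanishes.\<close>
          have "es ! i \<otimes> es ! j = \<zero>"
            using orth[of "es ! i" "es ! j"] i j dist False by (auto simp: nth_eq_iff_index_eq)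
          then show ?thesis
            using False yc[OF i] ei ej by (metis mult_assoc mult_zero)
        qed
        then have "(\<Oplus>i \<in> {..<length es}. ys ! i \<otimes> es ! j)
            = (\<Oplus>i \<in> {..<length es}. if j = i then ys ! i else \<zero>)"
          using yc by (intro finsum_cong') auto
        also have "\<dots> = ys ! j" using j by (intro finsum_singleton Pi) auto
        finally show ?thesis unfolding x_def finsum_mult[OF ej Pi] .
      qed
      then have "ys = ?h x" using len by (intro nth_equalityI) auto
      with x show "ys \<in> ?h ` carrier R" by blast
    qed
  qed
  ultimately show ?thesis
    using hom(2,3) by (auto simp: pseudoring_iso_def bij_betw_def)
qed

section \<open>Idempotents as sums of minimal ones\<close>

text \<open>Multiply the identity by \<open>f\<close>: the summand \<open>e \<otimes> f\<close> is
  \<open>e\<close> when \<open>e\<close> lies below \<open>f\<close>, and \<open>\<zero>\<close>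
  otherwise.\<close>

lemma idempotent_eq_sum_minimal:
  assumes fin: "finite (minimal_idempotents R)"
    and ident: "is_identity R (\<Oplus>e \<in> minimal_idempotents R. e)"
    and f: "f \<in> idempotents R"
  shows "f = (\<Oplus>e \<in> {e \<in> minimal_idempotents R. idem_le R e f}. e)"
proof -
  let ?E = "minimal_idempotents R" and ?S = "{e \<in> minimal_idempotents R. idem_le R e f}"
  have fc: "f \<in> carrier R" using f by (simp add: idempotents_def)
  have Ec: "(\<lambda>e. e) \<in> ?E \<rightarrow> carrier R" by (auto dest: minimal_idempotentD(1))
  have ef: "e \<otimes> f = (if e \<in> ?S then e else \<zero>)" if "e \<in> ?E" for e
    using minimal_idempotent_mult_idempotent[OF that f] that by (auto simp: idem_le_def)
  have "f = (\<Oplus>e \<in> ?E. e \<otimes> f)"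
    using ident fc finsum_mult[OF fc Ec] by (simp add: is_identity_def)
  also have "\<dots> = (\<Oplus>e \<in> ?S. e)"
    by (rule add.finprod_mono_neutral_cong_right)
      (use fin Ec ef fc in \<open>auto simp: mult_closed\<close>)
  finally show ?thesis .
qed

end

text \<open>The minimal idempotents are enumerated by a list because \<open>RDirProd_list\<close>
  takes one; for \<open>es = []\<close> the identity is the empty sum \<open>\<zero>\<close>, so
  \<open>M\<close> is the zero ring.\<close>

theorem theorem3p4:
  fixes M :: "('a, 'm) ring_scheme" (structure) and es :: "'a list"
  assumes "pseudomeadow M"
    and "finite (minimal_idempotents M)"
    and "\<And>e. e \<in> idempotents M \<Longrightarrow> e \<noteq> \<zero> \<Longrightarrow> \<exists>e' \<in> minimal_idempotents M. idem_le M e' e"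
    and "distinct es" and "set es = minimal_idempotents M"
  shows "(meadow M \<and> is_identity M (\<Oplus>e \<in> set es. e)) \<and>
    ((\<forall>e \<in> set es. field (component M e)) \<and>
      is_pseudoring_iso M (RDirProd_list (map (component M) es))) \<and>
    (finite (idempotents M) \<and>
      (\<forall>f \<in> idempotents M. \<exists>S. S \<subseteq> minimal_idempotents M \<and> f = (\<Oplus>e \<in> S. e)))"
proof -
  interpret pseudomeadow M by fact
  let ?E = "minimal_idempotents M"
  have ident: "is_identity M (\<Oplus>e \<in> ?E. e)"
    using assms(2,3) by (rule sum_minimal_idempotents_is_identity)
  then have "meadow M" by unfold_locales blast
  moreover have "is_pseudoring_iso M (RDirProd_list (map (component M) es))"
    using component_decomposition_iso[of es] ident minimal_idempotents_orthogonal assms(4,5)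
    by (auto simp: is_pseudoring_iso_def dest: minimal_idempotentD(4))
  moreover have sums: "\<exists>S. S \<subseteq> ?E \<and> f = (\<Oplus>e \<in> S. e)" if "f \<in> idempotents M" for f
  proof (intro exI conjI)
    show "f = (\<Oplus>e \<in> {e \<in> ?E. idem_le M e f}. e)"
      using idempotent_eq_sum_minimal[OF assms(2) ident that] .
  qed auto
  moreover have "finite (idempotents M)"
  proof (rule finite_subset)
    \<comment> \<open>Every idempotent is the sum over some subset of the finite set
      \<open>?E\<close>, so there are at most as many as subsets.\<close>
    show "idempotents M \<subseteq> (\<lambda>S. \<Oplus>e \<in> S. e) ` Pow ?E" using sums by blast
    show "finite ((\<lambda>S. \<Oplus>e \<in> S. e) ` Pow ?E)" using assms(2) by simp
  qed
  ultimately show ?thesis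
    unfolding assms(5) using ident component_field by blast
qed

end
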